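(* Let $M$ be a symmetric matrix whose entries are monomials in $x_1,\ldots,x_s$ such that no $2\times2$ principal minor of $M$ is identically $0$. Suppose also that $S^{2\times2}_M$ has nonempty interior in $\mathbb{R}^s_{>0}$. Then $\operatorname{trop}(S_M)=\operatorname{trop}(S^{2\times2}_M)$.
   Context: For $\mathbf v\in\mathbb{R}^s_{\ge0}$, $M(\mathbf v)$ is $M$ evaluated at $\mathbf v$; $S_M=\{\mathbf v\in\mathbb{R}^s_{\ge0}: M(\mathbf v)\succeq0\}$ and $S^{2\times2}_M=\{\mathbf v\in\mathbb{R}^s_{\ge0}:$ all $2\times2$ principal minors of $M(\mathbf v)$ are nonnegative$\}$. $\operatorname{trop}(\mathcal S)$ is the set of $\mathbf y$ for which there exist $\tau_k\in(0,1)$, $\tau_k\to0$, $\mathbf y(k)\in\mathcal S\cap\mathbb{R}^s_{>0}$ with $\frac{-1}{\log_e\tau_k}(\log_e y(k)_1,\ldots,\log_e y(k)_s)\to\mathbf y$. *)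

theory Defs
  imports "HOL-Analysis.Analysis" "HOL-Library.Poly_Mapping"
begin

text \<open>Real polynomials in variables indexed by \<open>'s\<close>: finitely supported maps from exponent
  vectors to coefficients, multiplied by convolution.\<close>

type_synonym 's mpoly = "('s \<Rightarrow>\<^sub>0 nat) \<Rightarrow>\<^sub>0 real"

definition is_monomial :: "'s mpoly \<Rightarrow> bool" where
  "is_monomial p \<longleftrightarrow> (\<exists>\<alpha>. p = Poly_Mapping.single \<alpha> 1)"

definition mpoly_eval :: "'s::finite mpoly \<Rightarrow> real ^ 's \<Rightarrow> real" where
  "mpoly_eval p v = (\<Sum>\<alpha>\<in>Poly_Mapping.keys p.
     Poly_Mapping.lookup p \<alpha> * (\<Prod>i\<in>UNIV. (v $ i) ^ Poly_Mapping.lookup \<alpha> i))"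

lemma mpoly_eval_monomial:
  "mpoly_eval (Poly_Mapping.single \<alpha> 1) v = (\<Prod>i\<in>UNIV. (v $ i) ^ Poly_Mapping.lookup \<alpha> i)"
  by (simp add: mpoly_eval_def)

definition mat_eval :: "'s::finite mpoly ^ 'n ^ 'n \<Rightarrow> real ^ 's \<Rightarrow> real ^ 'n ^ 'n" where
  "mat_eval M v = (\<chi> i j. mpoly_eval (M $ i $ j) v)"

text \<open>The minor on rows and columns \<open>{i, j}\<close>; meaningful only for \<open>i \<noteq> j\<close>.\<close>

definition principal_minor2 :: "'a::comm_ring_1 ^ 'n ^ 'n \<Rightarrow> 'n \<Rightarrow> 'n \<Rightarrow> 'a" where
  "principal_minor2 A i j = A $ i $ i * A $ j $ j - A $ i $ j * A $ j $ i"

definition psd :: "real ^ 'n ^ 'n \<Rightarrow> bool" where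
  "psd A \<longleftrightarrow> transpose A = A \<and> (\<forall>x. 0 \<le> x \<bullet> (A *v x))"

definition nonneg_orthant :: "(real ^ 's) set" where
  "nonneg_orthant = {v. \<forall>i. 0 \<le> v $ i}"

definition pos_orthant :: "(real ^ 's) set" where
  "pos_orthant = {v. \<forall>i. 0 < v $ i}"

definition S_psd :: "'s::finite mpoly ^ 'n ^ 'n \<Rightarrow> (real ^ 's) set" where
  "S_psd M = {v \<in> nonneg_orthant. psd (mat_eval M v)}"

definition S_2x2 :: "'s::finite mpoly ^ 'n ^ 'n \<Rightarrow> (real ^ 's) set" where
  "S_2x2 M = {v \<in> nonneg_orthant. \<forall>i j. i \<noteq> j \<longrightarrow> 0 \<le> principal_minor2 (mat_eval M v) i j}"

definition trop :: "(real ^ 's) set \<Rightarrow> (real ^ 's) set" where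
  "trop S = {y. \<exists>(\<tau> :: nat \<Rightarrow> real) (Y :: nat \<Rightarrow> real ^ 's).
     (\<forall>k. 0 < \<tau> k \<and> \<tau> k < 1) \<and> \<tau> \<longlonglongrightarrow> 0 \<and>
     (\<forall>k. Y k \<in> S \<inter> pos_orthant) \<and>
     (\<lambda>k. (-1 / ln (\<tau> k)) *\<^sub>R (\<chi> i. ln (Y k $ i))) \<longlonglongrightarrow> y}"

end

theory Submission
  imports Defs
begin

text \<open>
  In logarithmic coordinates \<open>u\<close>, nonnegativity of the minor on \<open>{i, j}\<close> reads
  \<open>d\<^sub>i\<^sub>j \<bullet> u \<ge> 0\<close>, where \<open>d\<^sub>i\<^sub>j = a\<^sub>i\<^sub>i + a\<^sub>j\<^sub>j - 2 a\<^sub>i\<^sub>j\<close> is built from the exponent vectors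
  \<open>a\<^sub>i\<^sub>j\<close> of the entries. So the positive part of \<open>S\<^sup>2\<^sup>\<times>\<^sup>2\<close> is a polyhedral cone \<open>C\<close>, and its
  tropicalization lies in \<open>C\<close>. The vectors \<open>d\<^sub>i\<^sub>j\<close> are nonzero, hence an interior point of \<open>C\<close> has
  all \<open>d\<^sub>i\<^sub>j \<bullet> w > 0\<close>; a large multiple \<open>w\<close> of it satisfies
  \<open>d\<^sub>i\<^sub>j \<bullet> w \<ge> 2 ln n\<close>. For \<open>y \<in> C\<close> the points \<open>m y + w\<close> then give matrices whose
  off-diagonal entries are at most \<open>1/n\<close> times the geometric mean of the diagonal ones, which are
  positive semidefinite by Cauchy-Schwarz, and \<open>(m y + w) / m\<close> tends to \<open>y\<close>.
\<close>

definition ln_vec :: "real ^ 's \<Rightarrow> real ^ 's" where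
  "ln_vec v = (\<chi> i. ln (v $ i))"

definition exp_vec :: "real ^ 's \<Rightarrow> real ^ 's" where
  "exp_vec u = (\<chi> i. exp (u $ i))"

definition exponent_vec :: "('s \<Rightarrow>\<^sub>0 nat) \<Rightarrow> real ^ 's" where
  "exponent_vec \<alpha> = (\<chi> i. real (Poly_Mapping.lookup \<alpha> i))"

lemma exp_vec_pos [simp]: "exp_vec u \<in> pos_orthant"
  by (simp add: exp_vec_def pos_orthant_def)

lemma ln_exp_vec [simp]: "ln_vec (exp_vec u) = u"
  by (simp add: ln_vec_def exp_vec_def vec_eq_iff)

lemma exp_ln_vec: "v \<in> pos_orthant \<Longrightarrow> exp_vec (ln_vec v) = v"
  by (simp add: ln_vec_def exp_vec_def vec_eq_iff pos_orthant_def)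

lemma pos_orthant_subset: "pos_orthant \<subseteq> nonneg_orthant"
  by (auto simp: pos_orthant_def nonneg_orthant_def less_imp_le)

lemma open_pos_orthant: "open (pos_orthant :: (real ^ 's::finite) set)"
proof -
  have "pos_orthant = (\<Inter>i\<in>UNIV. {v :: real ^ 's. 0 < v $ i})"
    by (auto simp: pos_orthant_def)
  moreover have "open {v :: real ^ 's. 0 < v $ i}" for i
    by (intro open_Collect_less continuous_intros)
  ultimately show ?thesis by (metis finite open_INT)
qed

lemma continuous_exp_vec: "continuous_on UNIV (exp_vec :: real ^ 's::finite \<Rightarrow> real ^ 's)"
  unfolding exp_vec_def by (intro continuous_intros)

lemma exponent_vec_add: "exponent_vec (\<alpha> + \<beta>) = exponent_vec \<alpha> + exponent_vec \<beta>"
  by (simp add: exponent_vec_def vec_eq_iff lookup_add)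

lemma exponent_vec_inject: "exponent_vec \<alpha> = exponent_vec \<beta> \<longleftrightarrow> \<alpha> = \<beta>"
  by (auto simp: exponent_vec_def vec_eq_iff intro: poly_mapping_eqI)

lemma mpoly_eval_monomial_exp:
  fixes u :: "real ^ 's::finite"
  shows "mpoly_eval (Poly_Mapping.single \<alpha> 1) (exp_vec u) = exp (exponent_vec \<alpha> \<bullet> u)"
  by (simp add: mpoly_eval_monomial exp_vec_def exponent_vec_def inner_vec_def exp_sum
      exp_of_nat_mult)

text \<open>The quadratic form at the test vector \<open>c e_i - b e_j\<close> equals
  \<open>c\<close> times the minor, and \<open>c > 0\<close> can be cancelled.\<close>

lemma psd_imp_principal_minor2_nonneg:
  fixes A :: "real ^ 'n ^ 'n"
  assumes "psd A" and pos: "0 < A $ j $ j" and ij: "i \<noteq> j"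
  shows "0 \<le> principal_minor2 A i j"
proof -
  define a b c where "a = A $ i $ i" and "b = A $ i $ j" and "c = A $ j $ j"
  have "transpose A = A" using assms(1) by (simp add: psd_def)
  then have "transpose A $ i $ j = A $ i $ j" by simp
  then have sym: "A $ j $ i = b"
    by (simp add: transpose_def b_def)
  define x where "x = c *\<^sub>R axis i 1 - b *\<^sub>R axis j (1::real)"
  have "0 \<le> x \<bullet> (A *v x)" using assms(1) by (simp add: psd_def)
  also have "x \<bullet> (A *v x) = c * (a * c - b * b)"
    by (simp add: x_def inner_diff_left matrix_vector_mult_diff_distrib
        matrix_vector_mult_scaleR inner_axis' matrix_vector_mul_component inner_axis
        sym algebra_simps flip: a_def b_def c_def)
  finally have "0 \<le> a * c - b * b"
    using pos by (simp add: zero_le_mult_iff c_def)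
  then show ?thesis
    by (simp add: principal_minor2_def sym flip: a_def b_def c_def)
qed

lemma sqrt_exp: "sqrt (exp r) = exp (r / 2)"
  by (rule real_sqrt_unique) (simp_all flip: exp_of_nat_mult)

text \<open>With \<open>z i\<close> the diagonally weighted size of \<open>x $ i\<close>, the
  quadratic form is at least the sum of the squares of the \<open>z i\<close> minus the square of
  their sum over n. This is nonnegative by Cauchy-Schwarz against the all-ones vector.\<close>

lemma psd_if_off_diagonal_small:
  fixes A :: "real ^ 'n ^ 'n"
  assumes sym: "transpose A = A"
    and diag: "\<And>i. 0 \<le> A $ i $ i"
    and off: "\<And>i j. i \<noteq> j \<Longrightarrow> \<bar>A $ i $ j\<bar> \<le> sqrt (A $ i $ i) * sqrt (A $ j $ j) / CARD('n)"
  shows "psd A"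
  unfolding psd_def
proof (intro conjI allI)
  show "transpose A = A" by (fact sym)
next
  fix x :: "real ^ 'n"
  define n where "n = real CARD('n)"
  have n: "n > 0" by (simp add: n_def)
  define z where "z i = sqrt (A $ i $ i) * \<bar>x $ i\<bar>" for i
  have z: "(z i)\<^sup>2 = A $ i $ i * (x $ i)\<^sup>2" for i
    by (simp add: z_def power_mult_distrib diag)
  \<comment> \<open>Each diagonal term gives away \<open>z i * z i / n\<close>, so that the
    subtracted products run over all pairs and add up to a full square.\<close>
  have "(if i = j then (z i)\<^sup>2 else 0) - z i * z j / n \<le> x $ i * (A $ i $ j * x $ j)" for i j
  proof (cases "i = j")
    case True
    have "0 \<le> z i * z i / n" using n by simp
    then show ?thesis using True z[of i] by (simp add: power2_eq_square algebra_simps)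
  next
    case False
    have "\<bar>x $ i * (A $ i $ j * x $ j)\<bar> = \<bar>A $ i $ j\<bar> * (\<bar>x $ i\<bar> * \<bar>x $ j\<bar>)"
      by (simp add: abs_mult)
    also have "\<dots> \<le> sqrt (A $ i $ i) * sqrt (A $ j $ j) / n * (\<bar>x $ i\<bar> * \<bar>x $ j\<bar>)"
      unfolding n_def by (intro mult_right_mono off False) simp
    also have "\<dots> = z i * z j / n" by (simp add: z_def)
    finally show ?thesis using False by simp
  qed
  then have "(\<Sum>i\<in>UNIV. \<Sum>j\<in>UNIV. (if i = j then (z i)\<^sup>2 else 0) - z i * z j / n)
      \<le> (\<Sum>i\<in>UNIV. \<Sum>j\<in>UNIV. x $ i * (A $ i $ j * x $ j))"
    by (intro sum_mono)
  also have "\<dots> = x \<bullet> (A *v x)"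
    by (simp add: inner_vec_def matrix_vector_mult_def sum_distrib_left)
  finally have le: "(\<Sum>i\<in>UNIV. (z i)\<^sup>2) - (\<Sum>i\<in>UNIV. z i)\<^sup>2 / n \<le> x \<bullet> (A *v x)"
    by (simp add: sum_subtractf power2_eq_square sum_product flip: sum_divide_distrib)
  have "(\<Sum>i\<in>UNIV. z i)\<^sup>2 \<le> (\<Sum>i\<in>UNIV. (z i)\<^sup>2) * n"
    using Cauchy_Schwarz_ineq_sum[of z "\<lambda>_. 1" UNIV] by (simp add: n_def)
  then have "(\<Sum>i\<in>UNIV. z i)\<^sup>2 / n \<le> (\<Sum>i\<in>UNIV. (z i)\<^sup>2)"
    using n by (simp add: field_simps)
  with le show "0 \<le> x \<bullet> (A *v x)" by linarith
qed

lemma trop_mono_pos: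
  assumes "S \<inter> pos_orthant \<subseteq> T"
  shows "trop S \<subseteq> trop T"
proof
  fix y assume "y \<in> trop S"
  then obtain \<tau> :: "nat \<Rightarrow> real" and Y where
    "\<forall>k. 0 < \<tau> k \<and> \<tau> k < 1" "\<tau> \<longlonglongrightarrow> 0" "\<forall>k. Y k \<in> S \<inter> pos_orthant"
    "(\<lambda>k. (-1 / ln (\<tau> k)) *\<^sub>R (\<chi> i. ln (Y k $ i))) \<longlonglongrightarrow> y"
    unfolding trop_def by blast
  then show "y \<in> trop T" using assms unfolding trop_def by blast
qed

text \<open>The factors \<open>-1 / ln (\<tau> k)\<close> are positive, and a closed halfspace
  bounded by a hyperplane through 0 is stable under positive scaling and limits.\<close>

lemma trop_subset_halfspace:
  fixes S :: "(real ^ 's::finite) set"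
  assumes "\<And>v. v \<in> S \<inter> pos_orthant \<Longrightarrow> 0 \<le> d \<bullet> ln_vec v" and "y \<in> trop S"
  shows "0 \<le> d \<bullet> y"
proof -
  obtain \<tau> :: "nat \<Rightarrow> real" and Y where
    \<tau>: "\<forall>k. 0 < \<tau> k \<and> \<tau> k < 1" and Y: "\<forall>k. Y k \<in> S \<inter> pos_orthant"
    and lim: "(\<lambda>k. (-1 / ln (\<tau> k)) *\<^sub>R ln_vec (Y k)) \<longlonglongrightarrow> y"
    using assms(2) unfolding trop_def ln_vec_def by blast
  have "(\<lambda>k. d \<bullet> ((-1 / ln (\<tau> k)) *\<^sub>R ln_vec (Y k))) \<longlonglongrightarrow> d \<bullet> y"
    by (intro tendsto_intros lim)
  moreover have "0 \<le> d \<bullet> ((-1 / ln (\<tau> k)) *\<^sub>R ln_vec (Y k))" for k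
  proof -
    have "ln (\<tau> k) < 0" using \<tau> by simp
    then have "0 \<le> -1 / ln (\<tau> k)" by (simp add: divide_nonpos_neg)
    then show ?thesis
      unfolding inner_scaleR_right using assms(1) Y by (intro mult_nonneg_nonneg) auto
  qed
  ultimately show ?thesis
    by (intro LIMSEQ_le_const) auto
qed

lemma trop_contains_direction:
  fixes S :: "(real ^ 's::finite) set"
  assumes "\<And>m. 0 \<le> m \<Longrightarrow> exp_vec (m *\<^sub>R y + w) \<in> S"
  shows "y \<in> trop S"
proof -
  \<comment> \<open>This choice makes the scaling factor exactly \<open>1 / Suc k\<close>, so the
    offset \<open>w\<close> fades out. Starting at \<open>Suc k\<close> keeps
    \<open>\<tau> 0\<close> below 1.\<close>
  define \<tau> where "\<tau> k = exp (- real (Suc k))" for k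
  define Y where "Y k = exp_vec (real (Suc k) *\<^sub>R y + w)" for k
  have "(\<lambda>k. y + (1 / real (Suc k)) *\<^sub>R w) \<longlonglongrightarrow> y + 0 *\<^sub>R w"
    by (intro tendsto_intros LIMSEQ_Suc[OF lim_1_over_n])
  moreover have "(-1 / ln (\<tau> k)) *\<^sub>R ln_vec (Y k) = y + (1 / real (Suc k)) *\<^sub>R w" for k
  proof -
    have "-1 / ln (\<tau> k) = 1 / real (Suc k)"
      unfolding \<tau>_def ln_exp by (rule minus_divide_divide)
    moreover have "ln_vec (Y k) = real (Suc k) *\<^sub>R y + w"
      by (simp add: Y_def)
    ultimately show ?thesis
      by (simp only: scaleR_add_right scaleR_scaleR) simp
  qed
  ultimately have "(\<lambda>k. (-1 / ln (\<tau> k)) *\<^sub>R (\<chi> i. ln (Y k $ i))) \<longlonglongrightarrow> y"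
    by (simp add: ln_vec_def)
  moreover have "\<tau> \<longlonglongrightarrow> 0"
    unfolding \<tau>_def
    by (intro filterlim_compose[OF exp_at_bot] filterlim_compose[OF filterlim_uminus_at_bot_at_top]
        filterlim_compose[OF filterlim_real_sequentially] filterlim_Suc)
  moreover have "0 < \<tau> k \<and> \<tau> k < 1" for k
    by (simp add: \<tau>_def)
  moreover have "Y k \<in> S \<inter> pos_orthant" for k
    using assms by (simp add: Y_def)
  ultimately show ?thesis unfolding trop_def by blast
qed

text \<open>A small step from \<open>u\<close> against \<open>d\<close> stays in \<open>U\<close>
  and lowers the inner product by a positive amount, so it could not have been 0.\<close>

lemma inner_pos_at_interior:
  fixes d u :: "'a::real_inner"
  assumes "open U" "u \<in> U" "\<And>w. w \<in> U \<Longrightarrow> 0 \<le> d \<bullet> w" "d \<noteq> 0"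
  shows "0 < d \<bullet> u"
proof -
  have "((\<lambda>e. u - e *\<^sub>R d) \<longlongrightarrow> u - 0 *\<^sub>R d) (at_right 0)"
    by (intro tendsto_intros)
  then have "eventually (\<lambda>e. u - e *\<^sub>R d \<in> U) (at_right 0)"
    using assms(1,2) by (auto dest: topological_tendstoD)
  moreover have "eventually (\<lambda>e::real. 0 < e) (at_right 0)"
    by (rule eventually_at_right_less)
  ultimately have "eventually (\<lambda>e. 0 < e \<and> u - e *\<^sub>R d \<in> U) (at_right 0)"
    by eventually_elim simp
  then obtain e :: real where e: "0 < e" "u - e *\<^sub>R d \<in> U"
    using eventually_happens' by (metis (lifting) trivial_limit_at_right_real)
  have "0 \<le> d \<bullet> u - e * (d \<bullet> d)"
    using assms(3)[OF e(2)] by (simp add: inner_diff_right)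
  moreover have "0 < e * (d \<bullet> d)" using e assms(4) by simp
  ultimately show ?thesis by linarith
qed

theorem theorem4p4:
  fixes M :: "'s::finite mpoly ^ 'n ^ 'n"
  assumes "transpose M = M"
    and "\<forall>i j. is_monomial (M $ i $ j)"
    and "\<forall>i j. i \<noteq> j \<longrightarrow> principal_minor2 M i j \<noteq> 0"
    and "(top_of_set pos_orthant) interior_of (S_2x2 M) \<noteq> {}"
  shows "trop (S_psd M) = trop (S_2x2 M)"
proof -
  obtain \<alpha> where \<alpha>: "\<And>i j. M $ i $ j = Poly_Mapping.single (\<alpha> i j) 1"
    using assms(2) unfolding is_monomial_def by metis
  have sym: "M $ j $ i = M $ i $ j" for i j
    using arg_cong[OF assms(1), of "\<lambda>M. M $ i $ j"] by (simp add: transpose_def)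
  define a where "a i j = exponent_vec (\<alpha> i j)" for i j
  have entry: "mat_eval M (exp_vec u) $ i $ j = exp (a i j \<bullet> u)" for u i j
    by (simp add: mat_eval_def \<alpha> a_def mpoly_eval_monomial_exp)
  have mat_sym: "transpose (mat_eval M v) = mat_eval M v" for v
    by (simp add: transpose_def mat_eval_def vec_eq_iff sym)
  \<comment> \<open>The key set of a monomial is the singleton of its exponent, so equal entries
    have equal exponents.\<close>
  have a_sym: "a j i = a i j" for i j
    using arg_cong[OF sym[of j i], of Poly_Mapping.keys] by (simp add: \<alpha> a_def)
  define d where "d i j = a i i + a j j - 2 *\<^sub>R a i j" for i j
  \<comment> \<open>If \<open>d i j\<close> were 0, the two monomials in the minor would coincide
    and cancel identically.\<close>
  have d_nz: "d i j \<noteq> 0" if "i \<noteq> j" for i j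
  proof
    assume "d i j = 0"
    then have "exponent_vec (\<alpha> i i + \<alpha> j j) = exponent_vec (\<alpha> i j + \<alpha> j i)"
      using a_sym[of j i] by (simp add: d_def a_def exponent_vec_add scaleR_2)
    then have "principal_minor2 M i j = 0"
      by (simp add: exponent_vec_inject principal_minor2_def \<alpha> mult_single)
    with assms(3) that show False by blast
  qed
  have minor: "0 \<le> principal_minor2 (mat_eval M (exp_vec u)) i j \<longleftrightarrow> 0 \<le> d i j \<bullet> u" for u i j
    by (simp add: principal_minor2_def entry a_sym[of j i] d_def inner_add_left inner_diff_left
        flip: exp_add)
  have cone: "v \<in> S_2x2 M \<longleftrightarrow> (\<forall>i j. i \<noteq> j \<longrightarrow> 0 \<le> d i j \<bullet> ln_vec v)"
    if "v \<in> pos_orthant" for v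
    using minor[of "ln_vec v"] that pos_orthant_subset
    by (auto simp: S_2x2_def exp_ln_vec)

  have "S_psd M \<inter> pos_orthant \<subseteq> S_2x2 M"
  proof
    fix v assume v: "v \<in> S_psd M \<inter> pos_orthant"
    \<comment> \<open>At positive points the entries are exponentials; this supplies the positive
      diagonal entry that the minor criterion asks for.\<close>
    have "0 < mat_eval M v $ j $ j" for j
      using entry[of "ln_vec v"] v by (simp add: exp_ln_vec)
    with v show "v \<in> S_2x2 M"
      by (auto simp: S_psd_def S_2x2_def intro!: psd_imp_principal_minor2_nonneg)
  qed
  then have "trop (S_psd M) \<subseteq> trop (S_2x2 M)" by (rule trop_mono_pos)

  moreover have "trop (S_2x2 M) \<subseteq> trop (S_psd M)"
  proof
    fix y assume y: "y \<in> trop (S_2x2 M)"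
    have dy: "0 \<le> d i j \<bullet> y" if "i \<noteq> j" for i j
      by (rule trop_subset_halfspace[OF _ y]) (use cone that in auto)
    obtain T v where T: "openin (top_of_set pos_orthant) T" "v \<in> T" "T \<subseteq> S_2x2 M"
      using assms(4) unfolding interior_of_def by blast
    then have "open T" "T \<subseteq> pos_orthant"
      using open_pos_orthant openin_open_eq by blast+
    define u where "u = ln_vec v"
    have du: "0 < d i j \<bullet> u" if "i \<noteq> j" for i j
    proof (rule inner_pos_at_interior)
      \<comment> \<open>Pulling \<open>T\<close> back to logarithmic coordinates turns the interior
        point into one of a region where the linear forms are nonnegative.\<close>
      show "open (exp_vec -` T)"
        using \<open>open T\<close> continuous_exp_vec by (rule open_vimage)
      show "u \<in> exp_vec -` T"
        using T(2) \<open>T \<subseteq> pos_orthant\<close> by (auto simp: u_def exp_ln_vec)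
      show "0 \<le> d i j \<bullet> w" if "w \<in> exp_vec -` T" for w
        using cone[of "exp_vec w"] that \<open>i \<noteq> j\<close> T(3) by auto
    qed (use d_nz that in auto)
    define n where "n = real CARD('n)"
    have "1 \<le> CARD('n)" using zero_less_card_finite by (simp add: Suc_leI)
    then have n: "1 \<le> n" by (simp add: n_def)
    obtain t where t: "\<And>i j. i \<noteq> j \<Longrightarrow> 2 * ln n \<le> t * (d i j \<bullet> u)"
    proof
      \<comment> \<open>One multiple must serve all of the finitely many pairs, hence the maximum.
        Diagonal pairs get the dummy value 0, since \<open>d i i = 0\<close>.\<close>
      define q where "q = (\<lambda>(i, j). if i = j then 0 else 2 * ln n / (d i j \<bullet> u))"
      fix i j :: 'n assume ij: "i \<noteq> j"
      have "q (i, j) \<le> Max (range q)" by (intro Max_ge) auto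
      then have "2 * ln n / (d i j \<bullet> u) \<le> Max (range q)" using ij by (simp add: q_def)
      then show "2 * ln n \<le> Max (range q) * (d i j \<bullet> u)"
        using du[OF ij] by (simp add: pos_divide_le_eq)
    qed
    show "y \<in> trop (S_psd M)"
    proof (rule trop_contains_direction)
      fix m :: real assume m: "0 \<le> m"
      define x where "x = m *\<^sub>R y + t *\<^sub>R u"
      have "psd (mat_eval M (exp_vec x))"
      proof (rule psd_if_off_diagonal_small)
        fix i j :: 'n assume ij: "i \<noteq> j"
        have "0 \<le> m * (d i j \<bullet> y)" using m dy[OF ij] by simp
        then have "2 * ln n \<le> d i j \<bullet> x"
          using t[OF ij] by (simp add: x_def inner_add_right)
        \<comment> \<open>Halving accounts for the 2 in \<open>2 * ln n\<close>: after
          exponentiation, \<open>ln n\<close> becomes the required factor 1/n and the halves become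
          square roots of the diagonal entries.\<close>
        then have "a i j \<bullet> x \<le> (a i i \<bullet> x) / 2 + (a j j \<bullet> x) / 2 - ln n"
          by (simp add: d_def inner_add_left inner_diff_left)
        then have "exp (a i j \<bullet> x) \<le> exp ((a i i \<bullet> x) / 2 + (a j j \<bullet> x) / 2 - ln n)"
          by simp
        also have "\<dots> = exp ((a i i \<bullet> x) / 2) * exp ((a j j \<bullet> x) / 2) / n"
          using n by (simp add: exp_diff exp_add)
        finally show "\<bar>mat_eval M (exp_vec x) $ i $ j\<bar> \<le> sqrt (mat_eval M (exp_vec x) $ i $ i)
            * sqrt (mat_eval M (exp_vec x) $ j $ j) / CARD('n)"
          by (simp add: entry n_def sqrt_exp)
      qed (simp_all add: mat_sym entry)
      then show "exp_vec (m *\<^sub>R y + t *\<^sub>R u) \<in> S_psd M"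
        using pos_orthant_subset exp_vec_pos by (auto simp: S_psd_def x_def)
    qed
  qed
  ultimately show ?thesis by blast
qed

end
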